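(* Suppose $F : [0,\infty) \to \mathbb{R}$. The following are equivalent. (1) Applied entrywise, the function $F$ preserves total non-negativity on the set of all rectangular matrices of arbitrary size. (2) Applied entrywise, the function $F$ preserves total non-negativity on the set of all real symmetric matrices of arbitrary size. (3) The function $F$ is constant or linear. In other words, there exists $c \geq 0$ such that either $F(x) \equiv c$, or else $F(x) = cx$ for all $x \geq 0$.
   Context: A (rectangular) real matrix is totally non-negative if every minor of it is non-negative. For a matrix $A = (a_{ij})$ with entries in $[0,\infty)$, $F[A] := (F(a_{ij}))$. "$F$ preserves total non-negativity on a set of matrices" means that $F[A]$ is totally non-negative for every totally non-negative matrix $A$ in that set. *)

theory Defs
  imports "Jordan_Normal_Form.DL_Submatrix" "Jordan_Normal_Form.Determinant"
begin

(* Rows and columns are selected in increasing order by submatrix. The case I = J = {}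
   only contributes the empty minor, which is 1. *)
definition totally_nonneg :: "real mat \<Rightarrow> bool" where
  "totally_nonneg A \<longleftrightarrow>
     (\<forall>I J. I \<subseteq> {..<dim_row A} \<longrightarrow> J \<subseteq> {..<dim_col A} \<longrightarrow> card I = card J \<longrightarrow>
        det (submatrix A I J) \<ge> 0)"

(* A function on [0,\<infinity>) is represented by a function on the reals whose values at negative
   arguments are never used: by totally_nonneg_entry, only matrices with entries in
   [0,\<infinity>) are tested here. *)
definition preserves_TN_on :: "(real \<Rightarrow> real) \<Rightarrow> real mat set \<Rightarrow> bool" where
  "preserves_TN_on F S \<longleftrightarrow> (\<forall>A\<in>S. totally_nonneg A \<longrightarrow> totally_nonneg (map_mat F A))"

definition symmetric_matrices :: "real mat set" where
  "symmetric_matrices = {A. transpose_mat A = A}"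

lemma totally_nonneg_entry:
  assumes "totally_nonneg A" "i < dim_row A" "j < dim_col A"
  shows "A $$ (i, j) \<ge> 0"
proof -
  have nn: "det (submatrix A {i} {j}) \<ge> 0"
    using assms unfolding totally_nonneg_def by simp
  have c: "card {a. a < dim_row A \<and> a \<in> {i}} = 1" "card {a. a < dim_col A \<and> a \<in> {j}} = 1"
    using assms(2,3) by (simp_all cong: conj_cong)
  have p: "pick {k} 0 = k" for k
    by (auto intro: Least_equality)
  have dims: "submatrix A {i} {j} \<in> carrier_mat 1 1"
    using c by (intro carrier_matI) (simp_all only: dim_submatrix)
  have "submatrix A {i} {j} $$ (0, 0) = A $$ (i, j)"
    using submatrix_index[of 0 A "{i}" 0 "{j}"] c p by simp
  moreover have "det (submatrix A {i} {j}) = submatrix A {i} {j} $$ (0, 0)"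
    using det_single[OF dims] .
  ultimately show ?thesis using nn by simp
qed

end

theory Submission
  imports Defs "HOL-Real_Asymp.Real_Asymp"
begin

text \<open>
  That constants and nonnegative multiples of the identity preserve total non-negativity is
  immediate from the behaviour of determinants. The content is the converse, and it is obtained by
  testing a preserver \<open>F\<close> on Gram matrices \<open>(\<langle>C\<^sub>i, C\<^sub>j\<rangle>)\<close> of the rows of totally non-negative arrays \<open>C\<close>
  with three columns. Such matrices are symmetric, and totally non-negative by the Cauchy--Binet
  formula (\<open>totally_nonneg_gram\<close>). Minors whose rows and
  columns differ supply the information that rectangular matrices would give.

  Rank one (\<open>preserver_exchange\<close>). For a vector \<open>(a, b, c, d)\<close> the upper right 2 by 2 block of the
  Gram matrix has vanishing determinant. Swapping \<open>c\<close> and \<open>d\<close> swaps the columns of this block, so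
  the minor of the image is both nonnegative and nonpositive. Hence
  \<open>F (a d) F (b c) = F (a c) F (b d)\<close>, that is, \<open>F (1) F (x y) = F (x) F (y)\<close>. If \<open>F (1) = 0\<close> then
  \<open>F\<close> vanishes, and if \<open>F (0) \<noteq> 0\<close> then \<open>F\<close> is constant. Otherwise \<open>F / F (1)\<close> is multiplicative.

  Rank two (\<open>preserver_ge_at_one\<close>, \<open>preserver_doubling\<close>). Two small matrices show that \<open>F / F (1)\<close>
  is at least 1 on \<open>[1, \<infinity>)\<close>, so it is a power \<open>x powr \<alpha>\<close>
  (\<open>multiplicative_ge_one_imp_powr\<close>), and that \<open>F (2) \<ge> 2 F (1)\<close>, so \<open>\<alpha> \<ge> 1\<close>.

  Rank three (\<open>preserver_powr_imp_le_one\<close>). Let \<open>P\<close> be a convex polygonal path of five points whose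
  middle three points are collinear and equally spaced. The matrix \<open>1 + \<epsilon> \<langle>P\<^sub>i, P\<^sub>j\<rangle>\<close> is a totally
  non-negative Gram matrix of rank three, so its minor of order four on the first four rows and
  last four columns is zero. After raising the entries to the power \<open>\<alpha>\<close>, this minor
  becomes \<open>- 8 \<alpha>\<^sup>3 (\<alpha> - 1) \<epsilon>\<^sup>4\<close> up to higher order: constant and linear Taylor terms fill only three
  dimensions, and the fourth has to come from the quadratic term, with a sign that the collinear
  points make negative. Hence \<open>\<alpha> \<le> 1\<close>.
\<close>

section \<open>Minors\<close>

lemma det_expand_first_row:
  fixes a :: "nat \<Rightarrow> nat \<Rightarrow> 'a :: comm_ring_1"
  shows "det (mat (Suc n) (Suc n) (\<lambda>(i, j). a i j)) =
    (\<Sum>j<Suc n. a 0 j * ((-1) ^ j *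
       det (mat n n (\<lambda>(i, l). a (Suc i) (if l < j then l else Suc l)))))"
proof -
  let ?A = "mat (Suc n) (Suc n) (\<lambda>(i, j). a i j)"
  have del: "mat_delete ?A 0 j = mat n n (\<lambda>(i, l). a (Suc i) (if l < j then l else Suc l))"
    if "j < Suc n" for j
    by (rule eq_matI) (use that in \<open>auto simp: mat_delete_def\<close>)
  have "det ?A = (\<Sum>j<Suc n. ?A $$ (0, j) * cofactor ?A 0 j)"
    by (rule laplace_expansion_row) auto
  also have "\<dots> = (\<Sum>j<Suc n. a 0 j * ((-1) ^ j *
       det (mat n n (\<lambda>(i, l). a (Suc i) (if l < j then l else Suc l)))))"
    by (rule sum.cong) (auto simp: cofactor_def del)
  finally show ?thesis .
qed

lemma det_0: "det (mat 0 0 (\<lambda>(i, j). a i j)) = (1 :: 'a :: comm_ring_1)"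
  by (simp add: det_dim_zero)

lemma det_1:
  fixes a :: "nat \<Rightarrow> nat \<Rightarrow> 'a :: comm_ring_1"
  shows "det (mat (Suc 0) (Suc 0) (\<lambda>(i, j). a i j)) = a 0 0"
  by (subst det_expand_first_row) (simp add: det_0)

lemma det_2:
  fixes a :: "nat \<Rightarrow> nat \<Rightarrow> 'a :: comm_ring_1"
  shows "det (mat 2 2 (\<lambda>(i, j). a i j)) = a 0 0 * a 1 1 - a 0 1 * a 1 0"
  by (subst numeral_2_eq_2, subst numeral_2_eq_2, subst det_expand_first_row)
    (simp add: det_1)

lemma det_3:
  fixes a :: "nat \<Rightarrow> nat \<Rightarrow> 'a :: comm_ring_1"
  shows "det (mat 3 3 (\<lambda>(i, j). a i j)) =
      a 0 0 * (a 1 1 * a 2 2 - a 1 2 * a 2 1)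
    - a 0 1 * (a 1 0 * a 2 2 - a 1 2 * a 2 0)
    + a 0 2 * (a 1 0 * a 2 1 - a 1 1 * a 2 0)"
proof -
  have "det (mat (Suc 2) (Suc 2) (\<lambda>(i, j). a i j)) =
      a 0 0 * (a 1 1 * a 2 2 - a 1 2 * a 2 1)
    - a 0 1 * (a 1 0 * a 2 2 - a 1 2 * a 2 0)
    + a 0 2 * (a 1 0 * a 2 1 - a 1 1 * a 2 0)"
    by (subst det_expand_first_row) (simp add: det_2[unfolded numeral_2_eq_2] lessThan_Suc numeral_2_eq_2 algebra_simps)
  then show ?thesis by simp
qed

lemma det_4:
  fixes a :: "nat \<Rightarrow> nat \<Rightarrow> 'a :: comm_ring_1"
  shows "det (mat 4 4 (\<lambda>(i, j). a i j)) =
      a 0 0 * (a 1 1 * (a 2 2 * a 3 3 - a 2 3 * a 3 2)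
             - a 1 2 * (a 2 1 * a 3 3 - a 2 3 * a 3 1)
             + a 1 3 * (a 2 1 * a 3 2 - a 2 2 * a 3 1))
    - a 0 1 * (a 1 0 * (a 2 2 * a 3 3 - a 2 3 * a 3 2)
             - a 1 2 * (a 2 0 * a 3 3 - a 2 3 * a 3 0)
             + a 1 3 * (a 2 0 * a 3 2 - a 2 2 * a 3 0))
    + a 0 2 * (a 1 0 * (a 2 1 * a 3 3 - a 2 3 * a 3 1)
             - a 1 1 * (a 2 0 * a 3 3 - a 2 3 * a 3 0)
             + a 1 3 * (a 2 0 * a 3 1 - a 2 1 * a 3 0))
    - a 0 3 * (a 1 0 * (a 2 1 * a 3 2 - a 2 2 * a 3 1)
             - a 1 1 * (a 2 0 * a 3 2 - a 2 2 * a 3 0)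
             + a 1 2 * (a 2 0 * a 3 1 - a 2 1 * a 3 0))"  (is "_ = ?rhs")
proof -
  have "det (mat (Suc 3) (Suc 3) (\<lambda>(i, j). a i j)) = ?rhs"
    by (subst det_expand_first_row)
      (simp add: det_3[unfolded numeral_2_eq_2 numeral_3_eq_3] lessThan_Suc numeral_2_eq_2 numeral_3_eq_3
        algebra_simps)
  then show ?thesis by simp
qed

lemma pick_image:
  fixes f :: "nat \<Rightarrow> nat"
  assumes f: "strict_mono_on {..<k} f" and i: "i < k"
  shows "pick (f ` {..<k}) i = f i"
proof -
  have inj: "inj_on f {..<k}"
    using f by (rule strict_mono_on_imp_inj_on)
  have "{a \<in> f ` {..<k}. a < f i} = f ` {..<i}"
    using f i by (auto simp: strict_mono_on_def) (metis imageI lessThan_iff linorder_neqE_nat less_asym)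
  then have "card {a \<in> f ` {..<k}. a < f i} = i"
    using inj i by (simp add: card_image inj_on_subset)
  then show ?thesis
    using pick_card_in_set[of "f i" "f ` {..<k}"] i by simp
qed

lemma submatrix_eq_mat_pick:
  assumes "I \<subseteq> {..<dim_row A}" "J \<subseteq> {..<dim_col A}"
  shows "submatrix A I J = mat (card I) (card J) (\<lambda>(i, j). A $$ (pick I i, pick J j))"
proof -
  have "{i. i < dim_row A \<and> i \<in> I} = I" "{j. j < dim_col A \<and> j \<in> J} = J"
    using assms by auto
  then show ?thesis by (simp add: submatrix_def)
qed

text \<open>
  A minor is more easily handled through the increasing enumerations of its rows and columns than
  through their sets: blocks of consecutive indices are shifts, and the entries
  are obtained by plain substitution.
\<close>
definition selection :: "nat \<Rightarrow> nat \<Rightarrow> (nat \<Rightarrow> nat) \<Rightarrow> bool" where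
  "selection k n f \<longleftrightarrow> strict_mono_on {..<k} f \<and> f ` {..<k} \<subseteq> {..<n}"

lemma selection_less: "selection k n f \<Longrightarrow> i < k \<Longrightarrow> f i < n"
  by (auto simp: selection_def)

lemma selection_mono: "selection k n f \<Longrightarrow> i < j \<Longrightarrow> j < k \<Longrightarrow> f i < f j"
  by (auto simp: selection_def strict_mono_on_def)

lemma selection_shift: "k + d \<le> n \<Longrightarrow> selection k n (\<lambda>i. i + d)"
  by (auto simp: selection_def strict_mono_on_def)

lemma totally_nonneg_iff_selection:
  "totally_nonneg A \<longleftrightarrow>
     (\<forall>k f g. selection k (dim_row A) f \<longrightarrow> selection k (dim_col A) g \<longrightarrow>
        0 \<le> det (mat k k (\<lambda>(i, j). A $$ (f i, g j))))"
proof (intro iffI allI impI)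
  fix k f g
  assume A: "totally_nonneg A"
    and f: "selection k (dim_row A) f" and g: "selection k (dim_col A) g"
  let ?I = "f ` {..<k}" and ?J = "g ` {..<k}"
  have card: "card ?I = k" "card ?J = k"
    using f g by (simp_all add: selection_def card_image strict_mono_on_imp_inj_on)
  have sub: "?I \<subseteq> {..<dim_row A}" "?J \<subseteq> {..<dim_col A}"
    using f g by (simp_all add: selection_def)
  have "submatrix A ?I ?J = mat k k (\<lambda>(i, j). A $$ (f i, g j))"
    unfolding submatrix_eq_mat_pick[OF sub] card
    by (rule eq_matI) (use f g in \<open>auto simp: selection_def pick_image\<close>)
  then show "0 \<le> det (mat k k (\<lambda>(i, j). A $$ (f i, g j)))"
    using A sub card unfolding totally_nonneg_def by metis
next
  assume A: "\<forall>k f g. selection k (dim_row A) f \<longrightarrow> selection k (dim_col A) g \<longrightarrow>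
        0 \<le> det (mat k k (\<lambda>(i, j). A $$ (f i, g j)))"
  have sel: "selection (card I) n (pick I)" if "I \<subseteq> {..<n}" for I n
    using that pick_in_set_le[of _ I] pick_mono_le[of _ I]
    by (auto simp: selection_def strict_mono_on_def)
  show "totally_nonneg A"
    unfolding totally_nonneg_def
    using A sel by (metis submatrix_eq_mat_pick)
qed

section \<open>Constant and linear functions preserve total non-negativity\<close>

lemma preserves_TN_on_const:
  assumes "c \<ge> 0" "\<And>x. x \<ge> 0 \<Longrightarrow> F x = c"
  shows "preserves_TN_on F S"
  unfolding preserves_TN_on_def
proof (intro ballI impI)
  fix A assume A: "totally_nonneg A"
  have "0 \<le> det (mat k k (\<lambda>(i, j). map_mat F A $$ (f i, g j)))"
    if f: "selection k (dim_row A) f" and g: "selection k (dim_col A) g" for k f g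
  proof -
    have eq: "mat k k (\<lambda>(i, j). map_mat F A $$ (f i, g j)) = mat k k (\<lambda>(i, j). c)" (is "_ = ?M")
      by (rule eq_matI)
        (use f g A in \<open>auto simp: selection_less intro!: assms(2) totally_nonneg_entry\<close>)
    consider "k = 0" | "k = Suc 0" | "k \<ge> 2" by linarith
    then have "0 \<le> det ?M"
    proof cases
      case 1
      then show ?thesis by (simp add: det_0)
    next
      case 2
      then show ?thesis using assms(1) by (simp add: det_1)
    next
      case 3
      have "det ?M = 0"
        by (rule det_identical_rows[of _ k 0 1]) (use 3 in \<open>auto intro!: eq_vecI\<close>)
      then show ?thesis by simp
    qed
    with eq show ?thesis by simp
  qed
  then show "totally_nonneg (map_mat F A)"
    by (simp add: totally_nonneg_iff_selection)
qed

lemma preserves_TN_on_linear: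
  assumes "c \<ge> 0" "\<And>x. x \<ge> 0 \<Longrightarrow> F x = c * x"
  shows "preserves_TN_on F S"
  unfolding preserves_TN_on_def
proof (intro ballI impI)
  fix A assume A: "totally_nonneg A"
  have "0 \<le> det (mat k k (\<lambda>(i, j). map_mat F A $$ (f i, g j)))"
    if f: "selection k (dim_row A) f" and g: "selection k (dim_col A) g" for k f g
  proof -
    let ?M = "mat k k (\<lambda>(i, j). A $$ (f i, g j))"
    have eq: "mat k k (\<lambda>(i, j). map_mat F A $$ (f i, g j)) = c \<cdot>\<^sub>m ?M"
      by (rule eq_matI)
        (use f g A in \<open>auto simp: selection_less intro!: assms(2) totally_nonneg_entry\<close>)
    have "0 \<le> det ?M"
      using A f g by (auto simp: totally_nonneg_iff_selection)
    then show ?thesis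
      using assms(1) by (simp add: eq)
  qed
  then show "totally_nonneg (map_mat F A)"
    by (simp add: totally_nonneg_iff_selection)
qed

section \<open>Gram matrices of rank at most three\<close>

definition gram :: "nat \<Rightarrow> (nat \<Rightarrow> nat \<Rightarrow> real) \<Rightarrow> real mat" where
  "gram n C = mat n n (\<lambda>(i, j). C i 0 * C j 0 + C i 1 * C j 1 + C i 2 * C j 2)"

lemma gram_symmetric: "gram n C \<in> symmetric_matrices"
  unfolding symmetric_matrices_def gram_def
  by (auto intro!: eq_matI simp: mult.commute)

text \<open>
  From order three on, the factors of a Gram matrix become square once they are padded with zero
  columns, so that the multiplicativity of the determinant applies. For order three this is the
  Cauchy--Binet formula; for larger orders the zero columns make the minor vanish.
\<close>
lemma det_gram_eq_mult:
  fixes C D :: "nat \<Rightarrow> nat \<Rightarrow> real"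
  assumes "k \<ge> 3"
  shows "det (mat k k (\<lambda>(i, j). C i 0 * D j 0 + C i 1 * D j 1 + C i 2 * D j 2)) =
    det (mat k k (\<lambda>(i, l). if l < 3 then C i l else 0)) *
    det (mat k k (\<lambda>(i, l). if l < 3 then D i l else 0))"
proof -
  let ?C = "mat k k (\<lambda>(i, l). if l < 3 then C i l else 0)"
  let ?D = "mat k k (\<lambda>(i, l). if l < 3 then D i l else 0)"
  have "mat k k (\<lambda>(i, j). C i 0 * D j 0 + C i 1 * D j 1 + C i 2 * D j 2)
      = ?C * transpose_mat ?D" (is "?L = _")
  proof (rule eq_matI)
    fix i j assume "i < dim_row (?C * transpose_mat ?D)" "j < dim_col (?C * transpose_mat ?D)"
    then have ij: "i < k" "j < k" by auto
    have "(?C * transpose_mat ?D) $$ (i, j)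
        = (\<Sum>l<k. (if l < 3 then C i l else 0) * (if l < 3 then D j l else 0))"
      using ij by (auto simp: scalar_prod_def lessThan_atLeast0 intro!: sum.cong)
    also have "\<dots> = (\<Sum>l<3. C i l * D j l)"
      using assms by (intro sum.mono_neutral_cong_right) auto
    also have "\<dots> = ?L $$ (i, j)"
      using ij by (simp add: eval_nat_numeral)
    finally show "?L $$ (i, j) = (?C * transpose_mat ?D) $$ (i, j)" by simp
  qed auto
  moreover have "det (?C * transpose_mat ?D) = det ?C * det ?D"
    by (subst det_mult[of _ k]) (auto simp: det_transpose[of _ k])
  ultimately show ?thesis by simp
qed

text \<open>
  Every minor of the Gram matrix is a sum of products of two minors of \<open>C\<close> of the same order, and
  only orders up to three contribute.
\<close>
lemma totally_nonneg_gram: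
  assumes c1: "\<And>i l. i < n \<Longrightarrow> l < 3 \<Longrightarrow> 0 \<le> C i l"
    and c2: "\<And>i j l m. i < j \<Longrightarrow> j < n \<Longrightarrow> l < m \<Longrightarrow> m < 3 \<Longrightarrow> C i m * C j l \<le> C i l * C j m"
    and c3: "\<And>i j k. i < j \<Longrightarrow> j < k \<Longrightarrow> k < n \<Longrightarrow>
        0 \<le> C i 0 * (C j 1 * C k 2 - C j 2 * C k 1)
          - C i 1 * (C j 0 * C k 2 - C j 2 * C k 0)
          + C i 2 * (C j 0 * C k 1 - C j 1 * C k 0)"
  shows "totally_nonneg (gram n C)"
proof -
  have "0 \<le> det (mat k k (\<lambda>(i, j). gram n C $$ (f i, g j)))"
    if f: "selection k n f" and g: "selection k n g" for k f g
  proof -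
    let ?M = "mat k k (\<lambda>(i, j). C (f i) 0 * C (g j) 0 + C (f i) 1 * C (g j) 1 + C (f i) 2 * C (g j) 2)"
    have eq: "mat k k (\<lambda>(i, j). gram n C $$ (f i, g j)) = ?M"
      by (rule eq_matI) (use f g in \<open>auto simp: selection_less gram_def\<close>)
    consider "k = 0" | "k = Suc 0" | "k = 2" | "k = 3" | "k \<ge> 4" by linarith
    then have "0 \<le> det ?M"
    proof cases
      case 1
      then show ?thesis by (simp add: det_0)
    next
      case 2
      then show ?thesis
        using f g by (auto simp: det_1 selection_less intro!: add_nonneg_nonneg mult_nonneg_nonneg c1)
    next
      case 3
      have minors: "0 \<le> C (h 0) l * C (h 1) m - C (h 0) m * C (h 1) l"
        if "selection k n h" "l < m" "m < 3" for h l m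
        using c2[of "h 0" "h 1" l m] that 3 selection_mono[of k n h 0 1] selection_less[of k n h 1]
        by simp
      \<comment> \<open>the Cauchy--Binet expansion of a minor of order two\<close>
      have "det ?M =
          (C (f 0) 0 * C (f 1) 1 - C (f 0) 1 * C (f 1) 0) * (C (g 0) 0 * C (g 1) 1 - C (g 0) 1 * C (g 1) 0)
        + (C (f 0) 0 * C (f 1) 2 - C (f 0) 2 * C (f 1) 0) * (C (g 0) 0 * C (g 1) 2 - C (g 0) 2 * C (g 1) 0)
        + (C (f 0) 1 * C (f 1) 2 - C (f 0) 2 * C (f 1) 1) * (C (g 0) 1 * C (g 1) 2 - C (g 0) 2 * C (g 1) 1)"
        unfolding 3 det_2 by (simp add: algebra_simps)
      also have "\<dots> \<ge> 0"
        by (intro add_nonneg_nonneg mult_nonneg_nonneg minors f g) simp_all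
      finally show ?thesis .
    next
      case 4
      have minors: "0 \<le> det (mat 3 3 (\<lambda>(i, l). if l < 3 then C (h i) l else 0))"
        if "selection k n h" for h
        unfolding det_3
        using c3[of "h 0" "h 1" "h 2"] that 4
          selection_mono[of k n h 0 1] selection_mono[of k n h 1 2] selection_less[of k n h 2]
        by simp
      show ?thesis
        using det_gram_eq_mult[of k "\<lambda>i. C (f i)" "\<lambda>i. C (g i)"] minors[OF f] minors[OF g] 4 by simp
    next
      case 5
      let ?N = "mat k k (\<lambda>(i, l). if l < 3 then C (f i) l else 0)"
      have N: "?N \<in> carrier_mat k k" by simp
      have "det ?N = (\<Sum>i<k. ?N $$ (i, 3) * cofactor ?N i 3)"
        by (rule laplace_expansion_column[OF N]) (use 5 in simp)
      also have "\<dots> = 0"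
        using 5 by simp
      finally show ?thesis
        using det_gram_eq_mult[of k "\<lambda>i. C (f i)" "\<lambda>i. C (g i)"] 5 by simp
    qed
    then show ?thesis by (simp add: eq)
  qed
  then show ?thesis
    by (simp add: totally_nonneg_iff_selection gram_def)
qed

text \<open>
  The form in which the hypothesis on \<open>F\<close> is used below: any choice of \<open>C\<close>, rows and columns
  gives one inequality between values of \<open>F\<close>.
\<close>
lemma gram_minor_nonneg:
  assumes F: "preserves_TN_on F symmetric_matrices" and C: "totally_nonneg (gram n C)"
    and f: "selection k n f" and g: "selection k n g"
  shows "0 \<le> det (mat k k (\<lambda>(i, j).
      F (C (f i) 0 * C (g j) 0 + C (f i) 1 * C (g j) 1 + C (f i) 2 * C (g j) 2)))" (is "0 \<le> det ?M")
proof -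
  have dims: "dim_row (map_mat F (gram n C)) = n" "dim_col (map_mat F (gram n C)) = n"
    by (simp_all add: gram_def)
  have "totally_nonneg (map_mat F (gram n C))"
    using F C gram_symmetric by (auto simp: preserves_TN_on_def)
  then have "0 \<le> det (mat k k (\<lambda>(i, j). map_mat F (gram n C) $$ (f i, g j)))"
    using f g unfolding totally_nonneg_iff_selection dims by blast
  also have "mat k k (\<lambda>(i, j). map_mat F (gram n C) $$ (f i, g j)) = ?M"
    by (rule eq_matI) (use f g in \<open>auto simp: selection_less gram_def\<close>)
  finally show ?thesis .
qed

section \<open>Rank one: a multiplicative functional equation\<close>

lemma totally_nonneg_gram_rank_one:
  assumes "\<And>i. i < n \<Longrightarrow> 0 \<le> u i"
  shows "totally_nonneg (gram n (\<lambda>i l. if l = 0 then u i else 0))"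
  by (rule totally_nonneg_gram) (use assms in auto)

text \<open>
  The number \<open>x\<close> occurs off the diagonal in the Gram matrix of the vector \<open>(1, x)\<close>.
\<close>
lemma preserver_nonneg:
  assumes F: "preserves_TN_on F symmetric_matrices" and "x \<ge> 0"
  shows "0 \<le> F x"
proof -
  let ?u = "\<lambda>i::nat. if i = 0 then 1 else x"
  have "totally_nonneg (gram 2 (\<lambda>i l. if l = 0 then ?u i else 0))"
    by (rule totally_nonneg_gram_rank_one) (use assms in auto)
  from gram_minor_nonneg[OF F this selection_shift[of "Suc 0" 0] selection_shift[of "Suc 0" 1]]
  show ?thesis by (simp add: det_1)
qed

text \<open>
  The upper right block of the Gram matrix of the vector \<open>(a, b, c, d)\<close> has entries \<open>a c\<close>, \<open>a d\<close>,
  \<open>b c\<close>, \<open>b d\<close> for every order of \<open>c\<close> and \<open>d\<close>, so exchanging the two reverses the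
  inequality.
\<close>
lemma preserver_exchange:
  assumes F: "preserves_TN_on F symmetric_matrices"
    and "a \<ge> 0" "b \<ge> 0" "c \<ge> 0" "d \<ge> 0"
  shows "F (a * d) * F (b * c) = F (a * c) * F (b * d)"
proof -
  have le: "F (a * d) * F (b * c) \<le> F (a * c) * F (b * d)"
    if "a \<ge> 0" "b \<ge> 0" "c \<ge> 0" "d \<ge> 0" for a b c d
  proof -
    let ?u = "\<lambda>i::nat. if i = 0 then a else if i = 1 then b else if i = 2 then c else d"
    have "totally_nonneg (gram 4 (\<lambda>i l. if l = 0 then ?u i else 0))"
      by (rule totally_nonneg_gram_rank_one) (use that in auto)
    from gram_minor_nonneg[OF F this selection_shift[of 2 0] selection_shift[of 2 2]]
    show ?thesis by (simp add: det_2)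
  qed
  show ?thesis
    using le[of a b c d] le[of a b d c] assms by simp
qed

lemma preserver_multiplicative:
  assumes "preserves_TN_on F symmetric_matrices" "x \<ge> 0" "y \<ge> 0"
  shows "F 1 * F (x * y) = F x * F y"
  using preserver_exchange[OF assms(1), of x 1 1 y] assms by (simp add: mult.commute)

section \<open>Rank two: monotonicity and doubling\<close>

text \<open>
  The matrix with rows \<open>(1, 1)\<close> and \<open>(1, t)\<close> is totally non-negative for \<open>t \<ge> 1\<close>.
\<close>
lemma preserver_ge_at_one:
  assumes F: "preserves_TN_on F symmetric_matrices" and "F 1 > 0" "t \<ge> 1"
  shows "F 1 \<le> F t"
proof -
  define C where "C = (\<lambda>i l::nat. if l = 0 then 1 else if l = 1 \<and> i = (1::nat) then sqrt (t - 1) else 0)"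
  have "totally_nonneg (gram 2 C)"
    by (rule totally_nonneg_gram) (use assms in \<open>auto simp: C_def\<close>)
  from gram_minor_nonneg[OF F this selection_shift[of 2 0] selection_shift[of 2 0]]
  have "F 1 * F 1 \<le> F 1 * F t"
    using assms by (simp add: det_2 C_def)
  with assms show ?thesis by simp
qed

text \<open>
  The matrix with rows \<open>(1, 1, 0)\<close>, \<open>(1, 2, 1)\<close>, \<open>(0, 1, 1)\<close> is totally non-negative and singular,
  and its determinant increases with the middle entry, so \<open>F\<close> must not shrink 2 relative to 1.
\<close>
lemma preserver_doubling:
  assumes F: "preserves_TN_on F symmetric_matrices" and "F 1 > 0" "F 0 = 0"
  shows "2 * F 1 \<le> F 2"
proof -
  define C :: "nat \<Rightarrow> nat \<Rightarrow> real" where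
    "C = (\<lambda>i l. if l = 0 \<and> i < 2 \<or> l = 1 \<and> i > 0 then 1 else 0)"
  have "totally_nonneg (gram 3 C)"
    by (rule totally_nonneg_gram) (auto simp: C_def)
  from gram_minor_nonneg[OF F this selection_shift[of 3 0] selection_shift[of 3 0]]
  have "0 \<le> F 1 * F 1 * (F 2 - 2 * F 1)"
    using assms by (simp add: det_3 C_def algebra_simps)
  moreover have "0 < F 1 * F 1"
    using assms by simp
  ultimately have "0 \<le> F 2 - 2 * F 1"
    by (metis mult_pos_neg not_le)
  then show ?thesis by simp
qed

section \<open>Monotone multiplicative functions are powers\<close>

text \<open>
  Nonnegativity makes \<open>h\<close> monotone, and comparing \<open>n x\<close> with the integers next to it bounds the
  deviation of \<open>n h (x)\<close> from \<open>n h (1) x\<close> by \<open>h (1)\<close>, uniformly in \<open>n\<close>.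
\<close>
lemma additive_nonneg_imp_linear:
  fixes h :: "real \<Rightarrow> real"
  assumes add: "\<And>x y. h (x + y) = h x + h y" and nonneg: "\<And>x. x \<ge> 0 \<Longrightarrow> h x \<ge> 0"
  shows "h x = h 1 * x"
proof -
  interpret additive h by standard (rule add)
  have mono: "h x \<le> h y" if "x \<le> y" for x y
    using nonneg[of "y - x"] that by (simp add: diff)
  have nat: "h (of_nat n * x) = of_nat n * h x" for n x
    by (induction n) (simp_all add: zero add algebra_simps)
  have int: "h (of_int m) = of_int m * h 1" for m
    by (cases m rule: int_cases2) (use nat[of _ 1] in \<open>simp_all add: minus\<close>)
  have bound: "real n * \<bar>h x - h 1 * x\<bar> \<le> h 1" for n
  proof -
    define m where "m = \<lfloor>real n * x\<rfloor>"
    have m: "of_int m \<le> real n * x" "real n * x \<le> of_int (m + 1)"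
      unfolding m_def by linarith+
    have h: "of_int m * h 1 \<le> real n * h x" "real n * h x \<le> of_int (m + 1) * h 1"
      using mono[OF m(1)] mono[OF m(2)] by (simp_all only: nat int)
    have h1: "of_int m * h 1 \<le> real n * x * h 1" "real n * x * h 1 \<le> of_int (m + 1) * h 1"
      using m nonneg[of 1] by (intro mult_right_mono; simp)+
    have "\<bar>real n * h x - real n * x * h 1\<bar> \<le> h 1"
      using h h1 by (simp add: algebra_simps abs_le_iff)
    moreover have "real n * \<bar>h x - h 1 * x\<bar> = \<bar>real n * h x - real n * x * h 1\<bar>"
      by (simp add: abs_mult_pos' algebra_simps)
    ultimately show ?thesis by simp
  qed
  show ?thesis
  proof (rule ccontr)
    assume "h x \<noteq> h 1 * x"
    then have pos: "0 < \<bar>h x - h 1 * x\<bar>" by simp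
    obtain n :: nat where "h 1 < real n * \<bar>h x - h 1 * x\<bar>"
      using reals_Archimedean3[OF pos] by blast
    with bound[of n] show False by simp
  qed
qed

text \<open>
  In logarithmic coordinates \<open>G\<close> becomes additive, and the bound on \<open>[1, \<infinity>)\<close> becomes nonnegativity on
  the positive half-line.
\<close>
lemma multiplicative_ge_one_imp_powr:
  fixes G :: "real \<Rightarrow> real"
  assumes mult: "\<And>x y. x > 0 \<Longrightarrow> y > 0 \<Longrightarrow> G (x * y) = G x * G y"
    and ge1: "\<And>t. t \<ge> 1 \<Longrightarrow> G t \<ge> 1"
  shows "\<exists>\<alpha>. \<forall>x>0. G x = x powr \<alpha>"
proof -
  have pos: "G x > 0" if "x > 0" for x
  proof (cases "x \<ge> 1")
    case True
    then show ?thesis using ge1[of x] by simp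
  next
    case False
    then have "G x * G (1 / x) = G 1"
      using mult[of x "1 / x"] that by simp
    moreover have "G (1 / x) \<ge> 1" "G 1 \<ge> 1"
      using False that ge1[of "1 / x"] ge1[of 1] by simp_all
    ultimately have "0 < G x * G (1 / x)" "0 < G (1 / x)"
      by linarith+
    then show ?thesis by (rule zero_less_mult_pos2)
  qed
  define h where "h t = ln (G (exp t))" for t
  have lin: "h t = h 1 * t" for t
  proof (rule additive_nonneg_imp_linear)
    show "h (x + y) = h x + h y" for x y
      using pos[of "exp x"] pos[of "exp y"] by (simp add: h_def exp_add mult ln_mult)
    show "0 \<le> h x" if "x \<ge> 0" for x
      using ge1[of "exp x"] that by (simp add: h_def)
  qed
  have "G x = x powr h 1" if "x > 0" for x
  proof -
    have "G x = exp (h (ln x))"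
      using pos[OF that] that by (simp add: h_def)
    then show ?thesis using that lin[of "ln x"] by (simp add: powr_def)
  qed
  then show ?thesis by blast
qed

section \<open>Rank three: exponents above one are excluded\<close>

text \<open>
  The rows are \<open>(1, \<delta> P\<^sub>i)\<close> for the path \<open>P\<close> in the plane that starts at the origin and has
  the edges \<open>e\<close>, \<open>f\<close>, \<open>f\<close>, \<open>g\<close> with \<open>e = (1, 0)\<close>, \<open>f = (1, 1)\<close>, \<open>g = (0, 1)\<close>. The path never
  turns right, which makes the minors of order three nonnegative, and its edges stay in the first
  quadrant. The first four points bend before a straight stretch, the last four
  after it.
\<close>
definition bent_rows :: "real \<Rightarrow> nat \<Rightarrow> nat \<Rightarrow> real" where
  "bent_rows \<delta> i l =
     (if l = 0 then 1
      else if l = 1 then \<delta> * [0, 1, 2, 3, 3] ! i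
      else \<delta> * [0, 0, 1, 2, 3] ! i)"

lemma totally_nonneg_gram_bent_rows:
  assumes "\<delta> \<ge> 0"
  shows "totally_nonneg (gram 5 (bent_rows \<delta>))"
proof (rule totally_nonneg_gram)
  show "0 \<le> bent_rows \<delta> i l" if "i < 5" "l < 3" for i l
  proof -
    from that have "i \<in> {0, 1, 2, 3, 4}" by auto
    with assms show ?thesis by (auto simp: bent_rows_def)
  qed
  show "bent_rows \<delta> i m * bent_rows \<delta> j l \<le> bent_rows \<delta> i l * bent_rows \<delta> j m"
    if "i < j" "j < 5" "l < m" "m < 3" for i j l m
  proof -
    from that have "(i, j) \<in> {(0,1), (0,2), (0,3), (0,4), (1,2), (1,3), (1,4), (2,3), (2,4), (3,4)}"
      by (simp; presburger)
    moreover from that have "(l, m) \<in> {(0,1), (0,2), (1,2)}"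
      by (simp; presburger)
    ultimately show ?thesis
      using assms by (auto simp: bent_rows_def)
  qed
  show "0 \<le> bent_rows \<delta> i 0 * (bent_rows \<delta> j 1 * bent_rows \<delta> k 2 - bent_rows \<delta> j 2 * bent_rows \<delta> k 1)
          - bent_rows \<delta> i 1 * (bent_rows \<delta> j 0 * bent_rows \<delta> k 2 - bent_rows \<delta> j 2 * bent_rows \<delta> k 0)
          + bent_rows \<delta> i 2 * (bent_rows \<delta> j 0 * bent_rows \<delta> k 1 - bent_rows \<delta> j 1 * bent_rows \<delta> k 0)"
    if "i < j" "j < k" "k < 5" for i j k
  proof -
    from that have "(i, j, k) \<in> {(0,1,2), (0,1,3), (0,1,4), (0,2,3), (0,2,4), (0,3,4),
        (1,2,3), (1,2,4), (1,3,4), (2,3,4)}"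
      by (simp; presburger)
    then show ?thesis
      using assms by (auto simp: bent_rows_def algebra_simps)
  qed
qed

lemma powr_second_order:
  fixes \<alpha> k :: real
  shows "((\<lambda>\<epsilon>. ((1 + k * \<epsilon>) powr \<alpha> - 1 - \<alpha> * k * \<epsilon>) / \<epsilon>\<^sup>2) \<longlongrightarrow> \<alpha> * (\<alpha> - 1) / 2 * k\<^sup>2)
    (at_right 0)"
proof (cases "k = 0")
  case False
  consider "k > 0" | "k < 0" using False by linarith
  then show ?thesis
  proof cases
    case 1
    then show ?thesis by (real_asymp simp: field_simps power2_eq_square)
  next
    case 2
    then show ?thesis by (real_asymp simp: field_simps power2_eq_square)
  qed
qed simp

text \<open>
  With \<open>P\<close> the path above, the entry at \<open>(i, j)\<close> is the inner product of \<open>P\<^sub>i\<close> and \<open>P\<^sub>j\<^sub>+\<^sub>1\<close>; it belongs to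
  the minor on the first four rows and the last four columns.
\<close>
definition bent_inner :: "nat \<Rightarrow> nat \<Rightarrow> real" where
  "bent_inner i j = [[0, 0, 0, 0], [1, 2, 3, 3], [2, 5, 8, 9], [3, 8, 13, 15]] ! i ! j"

text \<open>
  The first row is constant, so the determinant reduces to order three after subtracting the first
  column from the others. The points \<open>P\<^sub>1\<close>, \<open>P\<^sub>2\<close>, \<open>P\<^sub>3\<close> are equally spaced on a line and index both
  rows and columns; taking first and second differences along them puts second differences of \<open>q\<close>
  (those called \<open>t\<close> and \<open>s\<close>) in one row and one column of the reduced determinant. The term
  with \<open>t3\<close> is written first because it will dominate.
\<close>
lemma det_bent_pattern:
  fixes q :: "real \<Rightarrow> real"
  assumes "q 0 = 1"
  defines "e1 \<equiv> q 2 - q 1" and "y1 \<equiv> q 3 - q 1" and "t1 \<equiv> q 3 - 2 * q 2 + q 1"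
    and "e2 \<equiv> q 5 - 2 * q 2 + q 1" and "y2 \<equiv> q 9 - q 3 - q 2 + q 1"
    and "t2 \<equiv> q 8 - 2 * q 5 - q 3 + 3 * q 2 - q 1"
    and "t3 \<equiv> q 13 - 4 * q 8 + 4 * q 5 + 2 * q 3 - 4 * q 2 + q 1"
    and "s2 \<equiv> q 15 - 2 * q 9 + 2 * q 2 - q 1"
  shows "det (mat 4 4 (\<lambda>(i, j). q (bent_inner i j)))
    = t3 * (y1 * e2 - e1 * y2) + (e1 * t2 * s2 - t1 * (e2 * s2 - y2 * t2) - y1 * t2 * t2)"
  unfolding det_4 assms(2-) by (simp add: bent_inner_def assms(1) algebra_simps)

text \<open>
  Write \<open>c = \<alpha> (\<alpha> - 1) / 2\<close>. First differences of the entries are of size \<open>\<epsilon>\<close>. The linear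
  Taylor terms cancel in the second differences along the collinear points, which leaves size
  \<open>\<epsilon>\<^sup>2\<close>. In the expansion of \<open>det_bent_pattern\<close> the product with the mixed second difference
  \<open>t3\<close>, which tends to \<open>16 c\<close> after division by \<open>\<epsilon>\<^sup>2\<close>, has size \<open>\<epsilon>\<^sup>4\<close>, all others \<open>\<epsilon>\<^sup>5\<close>. Its
  cofactor tends to \<open>2 \<alpha> \<cdot> 2 \<alpha> - \<alpha> \<cdot> 5 \<alpha> = - \<alpha>\<^sup>2\<close> after division by \<open>\<epsilon>\<^sup>2\<close>, so a nonnegative
  determinant forces \<open>c \<le> 0\<close>.
\<close>
lemma powr_bent_pattern_imp_le_one:
  fixes \<alpha> :: real
  assumes "\<alpha> > 0"
    and nonneg: "\<And>\<epsilon>. \<epsilon> > 0 \<Longrightarrow> 0 \<le> det (mat 4 4 (\<lambda>(i, j).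
      (1 + bent_inner i j * \<epsilon>) powr \<alpha>))"
  shows "\<alpha> \<le> 1"
proof -
  \<comment> \<open>the quadratic Taylor remainders, and the differences of the entries divided by their order in \<open>\<epsilon>\<close>\<close>
  define r where "r k \<epsilon> = ((1 + k * \<epsilon>) powr \<alpha> - 1 - \<alpha> * k * \<epsilon>) / \<epsilon>\<^sup>2" for k \<epsilon>
  define c where "c = \<alpha> * (\<alpha> - 1) / 2"
  have r: "(r k \<longlongrightarrow> c * k\<^sup>2) (at_right 0)" for k
    unfolding r_def c_def by (rule powr_second_order)
  have id: "((\<lambda>\<epsilon>. \<epsilon>) \<longlongrightarrow> (0::real)) (at_right 0)"
    by (rule tendsto_ident_at)
  define e1 y1 e2 y2 t1 t2 t3 s2 where
    "e1 \<epsilon> = \<alpha> + \<epsilon> * (r 2 \<epsilon> - r 1 \<epsilon>)"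
    and "y1 \<epsilon> = 2 * \<alpha> + \<epsilon> * (r 3 \<epsilon> - r 1 \<epsilon>)"
    and "e2 \<epsilon> = 2 * \<alpha> + \<epsilon> * (r 5 \<epsilon> - 2 * r 2 \<epsilon> + r 1 \<epsilon>)"
    and "y2 \<epsilon> = 5 * \<alpha> + \<epsilon> * (r 9 \<epsilon> - r 3 \<epsilon> - r 2 \<epsilon> + r 1 \<epsilon>)"
    and "t1 \<epsilon> = r 3 \<epsilon> - 2 * r 2 \<epsilon> + r 1 \<epsilon>"
    and "t2 \<epsilon> = r 8 \<epsilon> - 2 * r 5 \<epsilon> - r 3 \<epsilon> + 3 * r 2 \<epsilon> - r 1 \<epsilon>"
    and "t3 \<epsilon> = r 13 \<epsilon> - 4 * r 8 \<epsilon> + 4 * r 5 \<epsilon> + 2 * r 3 \<epsilon> - 4 * r 2 \<epsilon> + r 1 \<epsilon>"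
    and "s2 \<epsilon> = r 15 \<epsilon> - 2 * r 9 \<epsilon> + 2 * r 2 \<epsilon> - r 1 \<epsilon>" for \<epsilon>
  note defs = e1_def y1_def e2_def y2_def t1_def t2_def t3_def s2_def
  define Q where "Q \<epsilon> = t3 \<epsilon> * (y1 \<epsilon> * e2 \<epsilon> - e1 \<epsilon> * y2 \<epsilon>) +
      \<epsilon> * (e1 \<epsilon> * t2 \<epsilon> * s2 \<epsilon> - t1 \<epsilon> * (e2 \<epsilon> * s2 \<epsilon> - y2 \<epsilon> * t2 \<epsilon>) - y1 \<epsilon> * t2 \<epsilon> * t2 \<epsilon>)" for \<epsilon>
  have "0 \<le> Q \<epsilon>" if \<epsilon>: "\<epsilon> > 0" for \<epsilon>
  proof -
    let ?q = "\<lambda>k. (1 + k * \<epsilon>) powr \<alpha>"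
    have q: "?q k = 1 + \<alpha> * k * \<epsilon> + \<epsilon>\<^sup>2 * r k \<epsilon>" for k
      using \<epsilon> by (simp add: r_def)
    have diffs:
      "?q 2 - ?q 1 = \<epsilon> * e1 \<epsilon>"
      "?q 3 - ?q 1 = \<epsilon> * y1 \<epsilon>"
      "?q 3 - 2 * ?q 2 + ?q 1 = \<epsilon>\<^sup>2 * t1 \<epsilon>"
      "?q 5 - 2 * ?q 2 + ?q 1 = \<epsilon> * e2 \<epsilon>"
      "?q 9 - ?q 3 - ?q 2 + ?q 1 = \<epsilon> * y2 \<epsilon>"
      "?q 8 - 2 * ?q 5 - ?q 3 + 3 * ?q 2 - ?q 1 = \<epsilon>\<^sup>2 * t2 \<epsilon>"
      "?q 13 - 4 * ?q 8 + 4 * ?q 5 + 2 * ?q 3 - 4 * ?q 2 + ?q 1 = \<epsilon>\<^sup>2 * t3 \<epsilon>"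
      "?q 15 - 2 * ?q 9 + 2 * ?q 2 - ?q 1 = \<epsilon>\<^sup>2 * s2 \<epsilon>"
      unfolding q defs by (simp_all add: algebra_simps power2_eq_square)
    have "0 \<le> det (mat 4 4 (\<lambda>(i, j).
        ?q (bent_inner i j)))"
      using nonneg[OF \<epsilon>] .
    also have "\<dots> = \<epsilon> ^ 4 * Q \<epsilon>"
      by (subst det_bent_pattern, simp, unfold diffs Q_def)
        (simp add: algebra_simps power2_eq_square power4_eq_xxxx)
    finally show ?thesis
      using \<epsilon> by (simp add: zero_le_mult_iff)
  qed
  then have "eventually (\<lambda>\<epsilon>. 0 \<le> Q \<epsilon>) (at_right 0)"
    by (auto simp: eventually_at_right_less intro: eventually_at_rightI[of 0 1])
  moreover have "(Q \<longlongrightarrow> - 16 * c * \<alpha>\<^sup>2) (at_right 0)"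
    unfolding Q_def defs
    by (rule tendsto_eq_intros r id refl | simp add: algebra_simps power2_eq_square)+
  ultimately have "0 \<le> - 16 * c * \<alpha>\<^sup>2"
    by (intro tendsto_lowerbound[of Q _ "at_right 0"]) auto
  then have "c \<le> 0"
    using assms(1) by (simp add: mult_le_0_iff)
  then show ?thesis
    using assms(1) by (simp add: c_def mult_le_0_iff)
qed

lemma bent_rows_inner:
  "bent_rows \<delta> i 0 * bent_rows \<delta> j 0 + bent_rows \<delta> i 1 * bent_rows \<delta> j 1
     + bent_rows \<delta> i 2 * bent_rows \<delta> j 2
   = 1 + ([0, 1, 2, 3, 3] ! i * [0, 1, 2, 3, 3] ! j + [0, 0, 1, 2, 3] ! i * [0, 0, 1, 2, 3] ! j) * \<delta>\<^sup>2"
  by (simp add: bent_rows_def power2_eq_square algebra_simps)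

text \<open>
  The scale \<open>\<delta> = sqrt \<epsilon>\<close> makes the Gram entries equal to \<open>1 + \<epsilon> \<langle>P\<^sub>i, P\<^sub>j\<rangle>\<close>.
\<close>
lemma preserver_powr_imp_le_one:
  assumes F: "preserves_TN_on F symmetric_matrices" and "c > 0" "\<alpha> > 0"
    and powr: "\<And>x. x > 0 \<Longrightarrow> F x = c * x powr \<alpha>"
  shows "\<alpha> \<le> 1"
proof (rule powr_bent_pattern_imp_le_one)
  fix \<epsilon> :: real assume \<epsilon>: "\<epsilon> > 0"
  let ?M = "mat 4 4 (\<lambda>(i, j). (1 + bent_inner i j * \<epsilon>) powr \<alpha>)"
  have K: "[0, 1, 2, 3, 3] ! i * [0, 1, 2, 3, 3] ! Suc j + [0, 0, 1, 2, 3] ! i * [0, 0, 1, 2, 3] ! Suc j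
      = bent_inner i j" "bent_inner i j \<ge> 0" if "i < 4" "j < 4" for i j
  proof -
    from that have "i \<in> {0, 1, 2, 3}" "j \<in> {0, 1, 2, 3}" by auto
    then show "[0, 1, 2, 3, 3] ! i * [0, 1, 2, 3, 3] ! Suc j + [0, 0, 1, 2, 3] ! i * [0, 0, 1, 2, 3] ! Suc j
      = bent_inner i j" "bent_inner i j \<ge> 0"
      by (auto simp: bent_inner_def)
  qed
  have "0 \<le> det (mat 4 4 (\<lambda>(i, j). F (1 +
      ([0, 1, 2, 3, 3] ! i * [0, 1, 2, 3, 3] ! Suc j + [0, 0, 1, 2, 3] ! i * [0, 0, 1, 2, 3] ! Suc j) * \<epsilon>)))"
    using gram_minor_nonneg[OF F totally_nonneg_gram_bent_rows[of "sqrt \<epsilon>"]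
        selection_shift[of 4 0] selection_shift[of 4 1]] \<epsilon>
    unfolding bent_rows_inner by simp
  also have "mat 4 4 (\<lambda>(i, j). F (1 +
      ([0, 1, 2, 3, 3] ! i * [0, 1, 2, 3, 3] ! Suc j + [0, 0, 1, 2, 3] ! i * [0, 0, 1, 2, 3] ! Suc j) * \<epsilon>))
      = c \<cdot>\<^sub>m ?M"
  proof (rule eq_matI)
    fix i j assume "i < dim_row (c \<cdot>\<^sub>m ?M)" "j < dim_col (c \<cdot>\<^sub>m ?M)"
    then have ij: "i < 4" "j < 4" by auto
    have "0 \<le> bent_inner i j * \<epsilon>"
      using K(2)[OF ij] \<epsilon> by (intro mult_nonneg_nonneg) auto
    then have "F (1 + bent_inner i j * \<epsilon>) = c * (1 + bent_inner i j * \<epsilon>) powr \<alpha>"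
      by (intro powr) linarith
    then show "mat 4 4 (\<lambda>(i, j). F (1 +
      ([0, 1, 2, 3, 3] ! i * [0, 1, 2, 3, 3] ! Suc j + [0, 0, 1, 2, 3] ! i * [0, 0, 1, 2, 3] ! Suc j) * \<epsilon>))
        $$ (i, j) = (c \<cdot>\<^sub>m ?M) $$ (i, j)"
      using ij K(1)[OF ij] by simp
  qed auto
  finally have "0 \<le> c ^ 4 * det ?M"
    by simp
  then show "0 \<le> det ?M"
    using \<open>c > 0\<close> by (simp add: zero_le_mult_iff)
qed fact

section \<open>Classification of preservers\<close>

lemma preserver_constant_or_linear:
  assumes F: "preserves_TN_on F symmetric_matrices"
  shows "\<exists>c\<ge>0. (\<forall>x\<ge>0. F x = c) \<or> (\<forall>x\<ge>0. F x = c * x)"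
proof -
  have mult: "F 1 * F (x * y) = F x * F y" if "x \<ge> 0" "y \<ge> 0" for x y
    using preserver_multiplicative[OF F that] .
  have F1: "F 1 \<ge> 0" using preserver_nonneg[OF F, of 1] by simp
  consider "F 1 = 0" | "F 1 > 0" "F 0 \<noteq> 0" | "F 1 > 0" "F 0 = 0"
    using F1 by linarith
  then show ?thesis
  proof cases
    case 1
    have "F x = 0" if "x \<ge> 0" for x
      using mult[OF that that] 1 by simp
    then show ?thesis by auto
  next
    case 2
    have "F x = F 1" if "x \<ge> 0" for x
      using mult[OF that, of 0] 2 by simp
    then show ?thesis using F1 by blast
  next
    case 3
    define c where "c = F 1"
    have c: "c > 0" using 3 by (simp add: c_def)
    have "\<exists>\<alpha>. \<forall>x>0. F x / c = x powr \<alpha>"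
    proof (rule multiplicative_ge_one_imp_powr)
      show "F (x * y) / c = F x / c * (F y / c)" if "x > 0" "y > 0" for x y
        using mult[of x y] that c by (simp add: c_def field_simps)
      show "1 \<le> F t / c" if "t \<ge> 1" for t
        using preserver_ge_at_one[OF F 3(1) that] c by (simp add: c_def)
    qed
    then obtain \<alpha> where powr: "F x = c * x powr \<alpha>" if "x > 0" for x
      using c by (auto simp: field_simps)
    have "2 * c \<le> F 2"
      using preserver_doubling[OF F 3] by (simp add: c_def)
    then have "2 powr 1 \<le> 2 powr \<alpha>"
      using powr[of 2] c by simp
    then have "\<alpha> \<ge> 1"
      by (subst (asm) powr_le_cancel_iff) simp_all
    moreover from this have "\<alpha> \<le> 1"
      using preserver_powr_imp_le_one[OF F c _ powr] by simp
    ultimately have "F x = c * x" if "x \<ge> 0" for x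
      using powr[of x] that 3(2) by (cases "x = 0") simp_all
    then show ?thesis using c by (intro exI[of _ c]) simp
  qed
qed

theorem theorem5p7:
  fixes F :: "real \<Rightarrow> real"
  shows "(preserves_TN_on F UNIV \<longleftrightarrow> preserves_TN_on F symmetric_matrices) \<and>
         (preserves_TN_on F symmetric_matrices \<longleftrightarrow>
            (\<exists>c\<ge>0. (\<forall>x\<ge>0. F x = c) \<or> (\<forall>x\<ge>0. F x = c * x)))"
proof -
  have "preserves_TN_on F UNIV \<Longrightarrow> preserves_TN_on F symmetric_matrices"
    by (simp add: preserves_TN_on_def)
  moreover have "preserves_TN_on F UNIV"
    if "\<exists>c\<ge>0. (\<forall>x\<ge>0. F x = c) \<or> (\<forall>x\<ge>0. F x = c * x)"
  proof -
    from that obtain c where "c \<ge> 0" "(\<forall>x\<ge>0. F x = c) \<or> (\<forall>x\<ge>0. F x = c * x)"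
      by blast
    then show ?thesis
      by (elim disjE) (simp_all add: preserves_TN_on_const preserves_TN_on_linear)
  qed
  ultimately show ?thesis
    using preserver_constant_or_linear by blast
qed

end
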